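(* Let $g\in H(\mathbb{D})$ and $0<p<\infty$. Then the operator $S_g\colon H^p\to H^p$ is compact if and only if $g=0$.
   Context: $\mathbb{D}$ is the open unit disk in $\mathbb{C}$, $H(\mathbb{D})$ is the space of analytic functions on $\mathbb{D}$, and $m$ is the normalized Lebesgue measure on $\partial\mathbb{D}$. For $0<p<\infty$, the Hardy space $H^p$ consists of all $f\in H(\mathbb{D})$ with $\|f\|_{H^p}=\left(\lim_{r\to1^-}\int_{\partial\mathbb{D}}|f(r\xi)|^p\,dm(\xi)\right)^{1/p}<\infty$. For $g\in H(\mathbb{D})$, the Volterra type operator $S_g$ is defined by $(S_gf)(z)=\int_0^z f'(\omega)g(\omega)\,d\omega$ for $z\in\mathbb{D}$, $f\in H(\mathbb{D})$. As usual (also in the quasi-Banach range $0<p<1$), $S_g\colon H^p\to H^p$ is compact if it maps $H^p$ into $H^p$ and the image of the unit ball of $H^p$ is relatively compact in $H^p$. *)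

theory Defs
  imports "HOL-Complex_Analysis.Complex_Analysis"
begin

abbreviation unit_disk :: "complex set" where
  "unit_disk \<equiv> ball 0 1"

text \<open>A function on the disk is represented by its extension by zero to the whole plane, so that
  HOL equality is equality on the disk and the metric below separates points.\<close>

definition hol_disk :: "(complex \<Rightarrow> complex) set" where
  "hol_disk = {f. f holomorphic_on unit_disk \<and> (\<forall>z. z \<notin> unit_disk \<longrightarrow> f z = 0)}"

definition circle_measure :: "complex measure" where
  "circle_measure = distr (uniform_measure lborel {0..2 * pi}) borel cis"

definition integral_mean :: "real \<Rightarrow> (complex \<Rightarrow> complex) \<Rightarrow> real \<Rightarrow> real" where
  "integral_mean p f r = (LINT \<xi>|circle_measure. norm (f (of_real r * \<xi>)) powr p)"

text \<open>The integral mean of a holomorphic function increases with the radius, so its limit at 1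
  always exists in the extended reals; it is finite iff it exists as a real limit.\<close>

definition hardy_space :: "real \<Rightarrow> (complex \<Rightarrow> complex) set" where
  "hardy_space p = {f \<in> hol_disk. \<exists>L. (integral_mean p f \<longlongrightarrow> L) (at_left 1)}"

definition hardy_norm :: "real \<Rightarrow> (complex \<Rightarrow> complex) \<Rightarrow> real" where
  "hardy_norm p f = (Lim (at_left 1) (integral_mean p f)) powr (1 / p)"

text \<open>For \<open>p < 1\<close> the quasi-norm violates the triangle inequality, but its \<open>p\<close>-th power satisfies it
  and induces the same topology.\<close>

definition hardy_dist :: "real \<Rightarrow> (complex \<Rightarrow> complex) \<Rightarrow> (complex \<Rightarrow> complex) \<Rightarrow> real" where
  "hardy_dist p f h = hardy_norm p (\<lambda>z. f z - h z) powr (min 1 p)"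

definition hardy_topology :: "real \<Rightarrow> (complex \<Rightarrow> complex) topology" where
  "hardy_topology p = Metric_space.mtopology (hardy_space p) (hardy_dist p)"

definition volterra_S :: "(complex \<Rightarrow> complex) \<Rightarrow> (complex \<Rightarrow> complex) \<Rightarrow> complex \<Rightarrow> complex" where
  "volterra_S g f z =
     (if z \<in> unit_disk then contour_integral (linepath 0 z) (\<lambda>w. deriv f w * g w) else 0)"

definition hardy_compact_operator ::
    "real \<Rightarrow> ((complex \<Rightarrow> complex) \<Rightarrow> (complex \<Rightarrow> complex)) \<Rightarrow> bool" where
  "hardy_compact_operator p T \<longleftrightarrow>
     T ` hardy_space p \<subseteq> hardy_space p \<and>
     compactin (hardy_topology p)
       (hardy_topology p closure_of (T ` {f \<in> hardy_space p. hardy_norm p f \<le> 1}))"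

end

theory Submission
  imports Defs
begin

text \<open>Locally \<open>|f|\<^sup>p\<close> dominates the modulus of a holomorphic function with equality at the centre
  (a branch of \<open>f\<^sup>p\<close>, or 0 at a zero of \<open>f\<close>), and rotated moduli can be added up without losing
  this property. Hence such functions obey a maximum principle, which for averages over roots of
  unity yields the monotonicity of the integral means. It follows that the \<open>H\<^sup>p\<close> norm
  bounds the first nonzero Taylor coefficient at 0. If \<open>g\<close> has leading term
  \<open>b z\<^sup>k\<close> with \<open>b \<noteq> 0\<close>, the leading term of \<open>S\<^sub>g z\<^sup>n\<close> has the coefficient \<open>b n / (n + k)\<close> and
  the degree \<open>n + k\<close>, so these images of unit vectors are uniformly separated and have no
  convergent subsequence.\<close>

section \<open>Holomorphic minorants and their maximum principle\<close>

definition holomorphic_minorant_at :: "(complex \<Rightarrow> real) \<Rightarrow> complex \<Rightarrow> bool" where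
  "holomorphic_minorant_at u a \<longleftrightarrow> (\<exists>e>0. \<exists>h. h holomorphic_on ball a e \<and>
     norm (h a) = u a \<and> (\<forall>z\<in>ball a e. norm (h z) \<le> u z))"

text \<open>Turning \<open>b\<close> into the direction of \<open>a\<close> gives equality in the
  triangle inequality. This lets two minorants be added without losing equality at the
  centre.\<close>

lemma norm_add_rotated:
  fixes a b :: complex
  obtains c where "norm c = 1" "norm (a + c * b) = norm a + norm b"
proof (cases "a = 0 \<or> b = 0")
  case True
  then show ?thesis using that[of 1] by auto
next
  case False
  define c where "c = sgn a / sgn b"
  have "sgn b \<noteq> 0" using False by (simp add: sgn_zero_iff)
  have c: "norm c = 1" using False by (simp add: c_def norm_divide norm_sgn)
  have "a = of_real (norm a) * sgn a" using False by (simp add: sgn_eq)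
  moreover have "c * b = of_real (norm b) * sgn a" using False by (simp add: c_def sgn_eq)
  ultimately have "a + c * b = sgn a * of_real (norm a + norm b)"
    by (metis distrib_right mult.commute of_real_add)
  then have "norm (a + c * b) = norm a + norm b"
    using False by (simp add: norm_mult norm_sgn del: of_real_add)
  then show ?thesis using that c by blast
qed

text \<open>A unimodular factor on the second minorant aligns the two values at \<open>a\<close>, so
  the moduli add up there; elsewhere the triangle inequality suffices.\<close>

lemma holomorphic_minorant_at_add:
  assumes "holomorphic_minorant_at u a" "holomorphic_minorant_at v a"
  shows "holomorphic_minorant_at (\<lambda>z. u z + v z) a"
proof -
  obtain d h where d: "d > 0" "h holomorphic_on ball a d" "norm (h a) = u a"
      "\<And>z. z \<in> ball a d \<Longrightarrow> norm (h z) \<le> u z"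
    using assms(1) unfolding holomorphic_minorant_at_def by blast
  obtain e k where e: "e > 0" "k holomorphic_on ball a e" "norm (k a) = v a"
      "\<And>z. z \<in> ball a e \<Longrightarrow> norm (k z) \<le> v z"
    using assms(2) unfolding holomorphic_minorant_at_def by blast
  obtain c where c: "norm c = 1" "norm (h a + c * k a) = norm (h a) + norm (k a)"
    using norm_add_rotated by blast
  have "norm (h z + c * k z) \<le> u z + v z" if "z \<in> ball a (min d e)" for z
  proof -
    have "norm (h z + c * k z) \<le> norm (h z) + norm (c * k z)" by (rule norm_triangle_ineq)
    also have "\<dots> \<le> u z + v z" using d(4)[of z] e(4)[of z] that by (simp add: norm_mult c)
    finally show ?thesis .
  qed
  moreover have "(\<lambda>z. h z + c * k z) holomorphic_on ball a (min d e)"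
    by (intro holomorphic_intros holomorphic_on_subset[OF d(2)] holomorphic_on_subset[OF e(2)]) auto
  ultimately show ?thesis
    unfolding holomorphic_minorant_at_def
    by (intro exI[of _ "min d e"] conjI exI[of _ "\<lambda>z. h z + c * k z"]) (use c d e in auto)
qed

lemma holomorphic_minorant_at_sum:
  assumes "finite I" "\<And>i. i \<in> I \<Longrightarrow> holomorphic_minorant_at (u i) a"
  shows "holomorphic_minorant_at (\<lambda>z. \<Sum>i\<in>I. u i z) a"
  using assms
proof (induction I rule: finite_induct)
  case empty
  have "holomorphic_minorant_at (\<lambda>z. 0) a" unfolding holomorphic_minorant_at_def
    by (intro exI[of _ 1] conjI exI[of _ "\<lambda>z. 0"]) auto
  then show ?case by simp
next
  case (insert i I)
  then show ?case by (simp add: holomorphic_minorant_at_add)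
qed

lemma holomorphic_minorant_at_rotate:
  assumes "holomorphic_minorant_at u (a * w)" "norm w = 1"
  shows "holomorphic_minorant_at (\<lambda>z. u (z * w)) a"
proof -
  obtain d h where d: "d > 0" "h holomorphic_on ball (a * w) d" "norm (h (a * w)) = u (a * w)"
      "\<And>z. z \<in> ball (a * w) d \<Longrightarrow> norm (h z) \<le> u z"
    using assms(1) unfolding holomorphic_minorant_at_def by blast
  have b: "z * w \<in> ball (a * w) d" if "z \<in> ball a d" for z
    using that assms(2)
    by (simp add: dist_norm flip: left_diff_distrib) (simp add: norm_mult)
  have "(\<lambda>z. h (z * w)) holomorphic_on ball a d"
    by (rule holomorphic_on_compose_gen[of "\<lambda>z. z * w" "ball a d" h "ball (a * w) d", unfolded o_def])
       (use d(2) b in \<open>auto intro!: holomorphic_intros\<close>)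
  then show ?thesis unfolding holomorphic_minorant_at_def
    using d b by (intro exI[of _ d] conjI exI[of _ "\<lambda>z. h (z * w)"]) auto
qed

lemma holomorphic_minorant_at_norm_powr:
  assumes "f holomorphic_on S" "open S" "a \<in> S" "p > 0"
  shows "holomorphic_minorant_at (\<lambda>z. norm (f z) powr p) a"
proof (cases "f a = 0")
  case True
  then show ?thesis unfolding holomorphic_minorant_at_def
    by (intro exI[of _ 1] conjI exI[of _ "\<lambda>z. 0"]) auto
next
  case False
  have "continuous_on S f" using assms holomorphic_on_imp_continuous_on by blast
  then obtain d where d: "d > 0" "ball a d \<subseteq> S \<inter> f -` (- {0})"
    using continuous_open_preimage[of S f "- {0}"] assms False
    by (metis ComplI IntI open_Compl closed_singleton openE singletonD vimageI)
  \<comment> \<open>The ball avoids the zeros of \<open>f\<close>, so a logarithm \<open>k\<close>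
    exists and \<open>exp (p * k)\<close> is a branch of the \<open>p\<close>-th power.\<close>
  obtain k where k: "k holomorphic_on ball a d" "\<And>z. z \<in> ball a d \<Longrightarrow> exp (k z) = f z"
    by (rule holomorphic_logarithm_exists[of "ball a d" f a])
       (use d assms in \<open>auto intro: holomorphic_on_subset\<close>)
  have n: "norm (exp (of_real p * k z)) = norm (f z) powr p" if "z \<in> ball a d" for z
    using k(2)[OF that, symmetric] by (simp add: powr_def)
  have "(\<lambda>z. exp (of_real p * k z)) holomorphic_on ball a d"
    by (intro holomorphic_intros k)
  then show ?thesis unfolding holomorphic_minorant_at_def
    using d n by (intro exI[of _ d] conjI exI[of _ "\<lambda>z. exp (of_real p * k z)"]) auto
qed

text \<open>At a maximum point of largest modulus, the holomorphic minorant is locally constant by the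
  maximum modulus principle, so there is a maximum point farther out.\<close>

lemma maximum_principle_holomorphic_minorant:
  assumes u: "continuous_on (cball 0 R) u" "\<And>a. a \<in> ball 0 R \<Longrightarrow> holomorphic_minorant_at u a"
    and B: "\<And>z. norm z = R \<Longrightarrow> u z \<le> B" and z: "norm z \<le> R"
  shows "u z \<le> B"
proof (rule ccontr)
  assume "\<not> u z \<le> B"
  have "R \<ge> 0" using z norm_ge_zero order_trans by blast
  obtain w where w: "w \<in> cball 0 R" "\<And>y. y \<in> cball 0 R \<Longrightarrow> u y \<le> u w"
    using continuous_attains_sup[of "cball 0 R" u] u(1) \<open>R \<ge> 0\<close> by auto
  define K where "K = cball 0 R \<inter> u -` {u w}"
  have "compact K" unfolding K_def
    using continuous_closed_preimage[OF u(1) closed_cball, of "{u w}"]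
    by (auto simp: compact_eq_bounded_closed intro: bounded_subset[OF bounded_cball])
  then obtain a where a: "a \<in> K" "\<And>y. y \<in> K \<Longrightarrow> norm y \<le> norm a"
    using continuous_attains_sup[of K norm] w(1) by (force simp: K_def intro: continuous_intros)
  have ua: "u a = u w" "norm a \<le> R" using a by (auto simp: K_def)
  have "u z \<le> u w" using w z by auto
  then have "norm a < R" using B[of a] ua \<open>\<not> u z \<le> B\<close> by force
  then obtain d h where d: "d > 0" "h holomorphic_on ball a d" "norm (h a) = u a"
      "\<And>y. y \<in> ball a d \<Longrightarrow> norm (h y) \<le> u y"
    using u(2)[of a] unfolding holomorphic_minorant_at_def by auto
  \<comment> \<open>The smaller radius keeps the ball inside \<open>cball 0 R\<close>, where
    \<open>u w\<close> is the maximum.\<close>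
  define e where "e = min d (R - norm a)"
  have e: "e > 0" "e \<le> d" "e \<le> R - norm a" using d(1) \<open>norm a < R\<close> by (auto simp: e_def)
  have R: "y \<in> cball 0 R" if "y \<in> ball a e" for y
  proof -
    have "norm y \<le> norm a + dist a y" by (metis dist_0_norm dist_triangle)
    then show ?thesis using that e by auto
  qed
  have "h constant_on ball a e"
  proof (rule maximum_modulus_principle)
    show "h holomorphic_on ball a e" by (rule holomorphic_on_subset[OF d(2)]) (use e in auto)
    show "norm (h y) \<le> norm (h a)" if "y \<in> ball a e" for y
      using d(4)[of y] w(2)[OF R[OF that]] that e ua d(3) by auto
  qed (use e in auto)
  then obtain c where c: "\<And>y. y \<in> ball a e \<Longrightarrow> h y = c" unfolding constant_on_def by blast
  \<comment> \<open>The point \<open>y\<close> lies \<open>e/2\<close> farther out on the ray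
    through \<open>a\<close>. Since \<open>sgn 0 = 0\<close>, the origin needs a direction of its
    own.\<close>
  define s where "s = (if a = 0 then 1 else sgn a)"
  define y where "y = a + of_real (e/2) * s"
  have s: "norm s = 1" by (simp add: s_def norm_sgn)
  have y: "y \<in> ball a e" using e s by (simp add: y_def dist_norm norm_mult)
  have "h a = c" "h y = c" using c y e by auto
  then have "u w \<le> u y" using d(3) d(4)[of y] y e ua by auto
  then have "y \<in> K" using w(2)[OF R[OF y]] R[OF y] by (auto simp: K_def)
  moreover have "norm y > norm a"
  proof (cases "a = 0")
    case True
    then show ?thesis using e s by (simp add: y_def norm_mult)
  next
    case False
    then have "y = of_real (norm a + e/2) * sgn a"
      by (simp add: y_def s_def sgn_eq field_simps)
    then have "norm y = norm a + e/2" using e False by (simp add: norm_mult norm_sgn del: of_real_add)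
    then show ?thesis using e by simp
  qed
  ultimately show False using a(2) by force
qed

section \<open>Monotonicity of circle integrals\<close>

text \<open>Unnormalised and taken over the angle, so that continuity on a compact interval gives
  integrability. For \<open>f\<close> in \<open>hol_disk\<close> and radii in [0,1), the integral
  mean is this integral for \<open>norm (f z) powr p\<close>, divided by
  \<open>2*pi\<close>.\<close>

definition circle_integral :: "(complex \<Rightarrow> real) \<Rightarrow> real \<Rightarrow> real" where
  "circle_integral u r = integral {0..2*pi} (\<lambda>t. u (of_real r * cis t))"

lemma dist_cis_le: "dist (cis s) (cis t) \<le> \<bar>s - t\<bar>"
proof -
  have "norm (cis s - cis t) \<le> 1 * norm (s - t)"
  proof (rule differentiable_bound[of UNIV cis "\<lambda>x h. h *\<^sub>R (\<i> * cis x)"])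
    show "onorm (\<lambda>h. h *\<^sub>R (\<i> * cis x)) \<le> 1" for x
      by (rule onorm_le) (simp add: norm_mult)
  qed (auto intro!: has_derivative_cis)
  then show ?thesis by (simp add: dist_norm)
qed

lemma continuous_on_circle:
  fixes u :: "complex \<Rightarrow> real"
  assumes "continuous_on (cball 0 R) u" "0 \<le> r" "r \<le> R"
  shows "continuous_on A (\<lambda>t. u (of_real r * cis t))"
  by (rule continuous_on_compose2[OF assms(1)])
     (use assms(2,3) in \<open>auto intro!: continuous_intros simp: norm_mult\<close>)

lemma integrable_on_circle:
  fixes u :: "complex \<Rightarrow> real"
  assumes "continuous_on (cball 0 R) u" "0 \<le> r" "r \<le> R"
  shows "(\<lambda>t. u (of_real r * cis t)) integrable_on {a..b}"
  by (rule integrable_continuous_real[OF continuous_on_circle[OF assms]])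

lemma integral_shift_real:
  fixes \<phi> :: "real \<Rightarrow> real"
  assumes "\<phi> integrable_on {a+c..b+c}"
  shows "integral {a..b} (\<lambda>t. \<phi> (t + c)) = integral {a+c..b+c} \<phi>"
proof (rule integral_unique)
  have "(\<lambda>t. t + - c) ` {a+c..b+c} = {a..b}"
    by (auto simp: image_iff intro!: bexI[of _ "_ + c"])
  then show "((\<lambda>t. \<phi> (t + c)) has_integral integral {a+c..b+c} \<phi>) {a..b}"
    using has_integral_affinity[of \<phi> "integral {a+c..b+c} \<phi>" "a+c" "b+c" 1 c] assms
    by (simp add: integrable_integral)
qed

text \<open>Rotation shifts the angle by the argument of \<open>w\<close>; periodicity moves the
  piece beyond \<open>2*pi\<close> back to the start of the interval.\<close>

lemma circle_integral_rotate:
  assumes "continuous_on (cball 0 R) u" "0 \<le> r" "r \<le> R" "norm w = 1"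
  shows "circle_integral (\<lambda>z. u (z * w)) r = circle_integral u r"
proof -
  obtain c where c: "0 \<le> c" "c < 2*pi" "w = cis c"
    using Arg2pi_ge_0[of w] Arg2pi_lt_2pi[of w] Arg2pi_eq[of w] assms(4) by (auto simp: cis_conv_exp)
  define \<phi> where "\<phi> t = u (of_real r * cis t)" for t
  have per: "\<phi> (t + 2*pi) = \<phi> t" for t by (simp add: \<phi>_def flip: cis_mult)
  have int: "\<phi> integrable_on {a..b}" for a b
    unfolding \<phi>_def by (rule integrable_on_circle[OF assms(1-3)])
  have "circle_integral (\<lambda>z. u (z * w)) r = integral {0..2*pi} (\<lambda>t. \<phi> (t + c))"
    by (simp add: circle_integral_def \<phi>_def c mult.assoc cis_mult)
  also have "\<dots> = integral {c..2*pi+c} \<phi>" by (simp add: integral_shift_real int)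
  also have "\<dots> = integral {c..2*pi} \<phi> + integral {2*pi..2*pi+c} \<phi>"
    using c by (subst Henstock_Kurzweil_Integration.integral_combine) (auto intro: int)
  also have "integral {2*pi..2*pi+c} \<phi> = integral {0..c} (\<lambda>t. \<phi> (t + 2*pi))"
    by (simp add: integral_shift_real int add.commute)
  also have "\<dots> = integral {0..c} \<phi>" by (simp add: per)
  also have "integral {c..2*pi} \<phi> + integral {0..c} \<phi> = integral {0..2*pi} \<phi>"
    using c by (subst add.commute, subst Henstock_Kurzweil_Integration.integral_combine) (auto intro: int)
  finally show ?thesis by (simp add: circle_integral_def \<phi>_def[abs_def])
qed

text \<open>Averaging over the \<open>n\<close>-th roots of unity keeps the holomorphic minorants and makes the
  function almost constant on the outer circle, where the maximum principle then applies.\<close>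

lemma circle_integral_mono:
  assumes u: "continuous_on (cball 0 R) u" "\<And>a. a \<in> ball 0 R \<Longrightarrow> holomorphic_minorant_at u a"
    and r: "0 \<le> r" "r \<le> R"
  shows "circle_integral u r \<le> circle_integral u R"
proof (rule field_le_epsilon)
  fix e :: real assume "e > 0"
  \<comment> \<open>A pointwise error of \<open>e'\<close> integrates to \<open>e\<close> over the
    full circle.\<close>
  define e' where "e' = e / (2*pi)"
  have e': "e' > 0" using \<open>e > 0\<close> by (simp add: e'_def)
  have "uniformly_continuous_on (cball 0 R) u"
    by (rule compact_uniformly_continuous[OF u(1) compact_cball])
  then obtain d where d: "d > 0"
      "\<And>x y. x \<in> cball 0 R \<Longrightarrow> y \<in> cball 0 R \<Longrightarrow> dist y x < d \<Longrightarrow> dist (u y) (u x) < e'"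
    by (rule uniformly_continuous_onE[OF _ e']) blast
  \<comment> \<open>Neighbouring points of a rotated set of \<open>n\<close>-th roots of unity on
    the circle of radius \<open>R\<close> are then closer than \<open>d\<close>.\<close>
  obtain n :: nat where n: "real n > 2*pi*R/d" using reals_Archimedean2 by blast
  have R: "R \<ge> 0" using r by simp
  have n0: "n > 0" using n d R
    by (metis divide_nonneg_pos gr0I less_le_not_le mult_nonneg_nonneg of_nat_0 pi_ge_zero zero_le_numeral)
  define \<omega> where "\<omega> = cis (2*pi/n)"
  \<comment> \<open>The sum replaces the average, so a factor \<open>n\<close> is carried along
    until the end.\<close>
  define F where "F z = (\<Sum>j<n. u (z * \<omega> ^ j))" for z
  have \<omega>: "norm (\<omega> ^ j) = 1" for j by (simp add: \<omega>_def norm_power)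
  have \<omega>n: "\<omega> ^ n = 1" using n0 by (simp add: \<omega>_def Complex.DeMoivre)
  have ucont: "continuous_on (cball 0 R) (\<lambda>z. u (z * \<omega> ^ j))" for j
    by (rule continuous_on_compose2[OF u(1)]) (auto intro!: continuous_intros simp: norm_mult \<omega>)
  have Fcont: "continuous_on (cball 0 R) F"
    unfolding F_def by (intro continuous_intros ucont)
  have Fmin: "holomorphic_minorant_at F a" if "a \<in> ball 0 R" for a
    unfolding F_def
    by (intro holomorphic_minorant_at_sum holomorphic_minorant_at_rotate u(2))
       (use that in \<open>auto simp: \<omega> norm_mult\<close>)
  have F1: "F (z * \<omega>) = F z" for z
  proof -
    define a where "a j = u (z * \<omega> ^ j)" for j
    have "F (z * \<omega>) = (\<Sum>j<n. a (Suc j))" by (simp add: F_def a_def mult.assoc)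
    also have "\<dots> = (\<Sum>j<Suc n. a j) - a 0" by (simp only: sum.lessThan_Suc_shift)
    also have "\<dots> = F z" by (simp add: F_def a_def \<omega>n)
    finally show ?thesis .
  qed
  have Fk: "F (z * \<omega> ^ k) = F z" for z k
  proof (induction k)
    case (Suc k)
    have "F (z * \<omega> ^ Suc k) = F ((z * \<omega> ^ k) * \<omega>)" by (simp add: mult_ac)
    also have "\<dots> = F z" unfolding F1 Suc ..
    finally show ?case .
  qed simp
  have Fint: "circle_integral F q = n * circle_integral u q" if q: "0 \<le> q" "q \<le> R" for q
  proof -
    have "circle_integral F q = (\<Sum>j<n. circle_integral (\<lambda>z. u (z * \<omega> ^ j)) q)"
      unfolding circle_integral_def F_def
      by (intro integral_sum) (auto intro: integrable_on_circle[OF ucont q])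
    also have "\<dots> = (\<Sum>j<n. circle_integral u q)"
      by (intro sum.cong refl circle_integral_rotate[OF u(1) q] \<omega>)
    finally show ?thesis by simp
  qed
  \<comment> \<open>Up to an angle of at most \<open>2*pi/n\<close>, \<open>z\<close> is a rotation
    of the point at angle \<open>t\<close> by a power of \<omega>, under which \<open>F\<close> is
    invariant. Each of the \<open>n\<close> summands then changes by less than
    \<open>e'\<close>.\<close>
  have osc: "F z \<le> F (of_real R * cis t) + n * e'" if z: "norm z = R" and t: "t \<in> {0..2*pi}" for z t
  proof -
    obtain s where s: "0 \<le> s" "z = of_real R * cis s"
      using Arg2pi_ge_0[of z] Arg2pi_eq[of z] z by (auto simp: cis_conv_exp)
    \<comment> \<open>\<open>k\<close> counts the steps of length \<open>2*pi/n\<close> that fit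
      between \<open>t\<close> and \<open>s + 2*pi\<close>. The added full turn makes this length
      nonnegative, so \<open>nat\<close> does not truncate.\<close>
    define k where "k = nat \<lfloor>(s + 2*pi - t) * n / (2*pi)\<rfloor>"
    define t' where "t' = t + 2*pi*k/n"
    have x: "(s + 2*pi - t) * n / (2*pi) \<ge> 0" using s t by auto
    then have "k \<le> (s + 2*pi - t) * n / (2*pi)" "(s + 2*pi - t) * n / (2*pi) < k + 1"
      unfolding k_def by linarith+
    then have k: "2*pi*k/n \<le> s + 2*pi - t" "s + 2*pi - t < 2*pi*(k+1)/n"
      using n0 by (simp_all add: field_simps)
    have *: "\<bar>s + 2*pi - t'\<bar> \<le> 2*pi/n"
    proof -
      have "2*pi*(k+1)/n = 2*pi*k/n + 2*pi/n" by (simp add: distrib_left add_divide_distrib)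
      moreover have "2*pi/n \<ge> 0" by simp
      ultimately show ?thesis using k unfolding t'_def by linarith
    qed
    have zs: "z = of_real R * cis (s + 2*pi)" using s by (simp flip: cis_mult)
    have "dist (cis (s + 2*pi)) (cis t') \<le> \<bar>s + 2*pi - t'\<bar>"
      by (rule dist_cis_le)
    then have "dist z (of_real R * cis t') \<le> R * (2*pi/n)"
    proof -
      have "dist z (of_real R * cis t') = R * dist (cis (s + 2*pi)) (cis t')"
        using R by (simp add: zs dist_norm norm_mult flip: right_diff_distrib)
      then show ?thesis using * R by (metis \<open>dist (cis (s + 2*pi)) (cis t') \<le> \<bar>s + 2*pi - t'\<bar>\<close> mult_left_mono order_trans)
    qed
    also have "\<dots> < d" using n n0 d by (simp add: field_simps)
    finally have dz: "dist z (of_real R * cis t') < d" .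
    have "u (z * \<omega> ^ j) \<le> u (of_real R * cis t' * \<omega> ^ j) + e'" for j
    proof -
      have "dist (z * \<omega> ^ j) (of_real R * cis t' * \<omega> ^ j) < d"
        using dz by (simp add: dist_norm norm_mult \<omega> flip: left_diff_distrib)
      then have "dist (u (z * \<omega> ^ j)) (u (of_real R * cis t' * \<omega> ^ j)) < e'"
        by (intro d(2)) (use z R in \<open>auto simp: norm_mult \<omega>\<close>)
      then show ?thesis by (simp add: dist_real_def)
    qed
    then have "F z \<le> (\<Sum>j<n. u (of_real R * cis t' * \<omega> ^ j) + e')"
      unfolding F_def by (intro sum_mono) auto
    also have "\<dots> = F (of_real R * cis t * \<omega> ^ k) + n * e'"
      by (simp add: F_def sum.distrib t'_def \<omega>_def Complex.DeMoivre mult_ac flip: cis_mult)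
    finally show ?thesis by (simp add: Fk)
  qed
  \<comment> \<open>Averaging \<open>osc\<close> over \<open>t\<close> bounds \<open>F\<close> on
    the outer circle by its mean there plus \<open>n * e'\<close>, which is
    \<open>C\<close>.\<close>
  define C where "C = (n * circle_integral u R + 2*pi*(n*e')) / (2*pi)"
  have bnd: "F z \<le> C" if "norm z = R" for z
  proof -
    have "integral {0..2*pi} (\<lambda>t. F z) \<le> integral {0..2*pi} (\<lambda>t. F (of_real R * cis t) + n * e')"
      by (intro integral_le integrable_add integrable_on_circle[OF Fcont] osc that) (use R in auto)
    also have "\<dots> = circle_integral F R + 2*pi*(n*e')"
      unfolding circle_integral_def
      by (subst Henstock_Kurzweil_Integration.integral_add)
         (use R in \<open>auto intro: integrable_on_circle[OF Fcont]\<close>)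
    finally show ?thesis using Fint[of R] R by (simp add: C_def field_simps)
  qed
  have "n * circle_integral u r = circle_integral F r" using Fint r by simp
  also have "\<dots> \<le> integral {0..2*pi} (\<lambda>t. C)"
    unfolding circle_integral_def
    by (intro integral_le integrable_on_circle[OF Fcont]
          maximum_principle_holomorphic_minorant[OF Fcont Fmin bnd]) (use r in \<open>auto simp: norm_mult\<close>)
  also have "\<dots> = n * (circle_integral u R + e)" by (simp add: C_def e'_def field_simps)
  finally show "circle_integral u r \<le> circle_integral u R + e" using n0 by simp
qed

lemma continuous_on_norm_powr:
  fixes f :: "complex \<Rightarrow> complex"
  assumes "continuous_on S f" "p > 0"
  shows "continuous_on S (\<lambda>z. norm (f z) powr p)"
  using assms by (intro continuous_on_powr' continuous_intros) auto

lemma circle_integral_norm_powr_mono: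
  assumes "f holomorphic_on ball 0 1" "p > 0" "0 \<le> r" "r \<le> R" "R < 1"
  shows "circle_integral (\<lambda>z. norm (f z) powr p) r \<le> circle_integral (\<lambda>z. norm (f z) powr p) R"
proof (rule circle_integral_mono)
  show "continuous_on (cball 0 R) (\<lambda>z. norm (f z) powr p)"
    using assms holomorphic_on_imp_continuous_on[OF assms(1)]
    by (intro continuous_on_norm_powr) (auto intro: continuous_on_subset)
  show "holomorphic_minorant_at (\<lambda>z. norm (f z) powr p) a" if "a \<in> ball 0 R" for a
    using assms that by (intro holomorphic_minorant_at_norm_powr[of f "ball 0 1"]) auto
qed (use assms in auto)

section \<open>Integral means and the Hardy norm\<close>

lemma borel_measurable_hol_disk:
  assumes "f \<in> hol_disk"
  shows "f \<in> borel_measurable borel"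
proof -
  have "(\<lambda>z. if z \<in> unit_disk then f z else 0) \<in> borel_measurable borel"
    using assms unfolding hol_disk_def
    by (intro borel_measurable_continuous_on_if) (auto intro: holomorphic_on_imp_continuous_on)
  also have "(\<lambda>z. if z \<in> unit_disk then f z else 0) = f" using assms by (auto simp: hol_disk_def)
  finally show ?thesis .
qed

text \<open>The pushforward under \<open>cis\<close> is undone, the uniform measure becomes the
  density \<open>1 / (2*pi)\<close> on the interval, and for the continuous integrand the Lebesgue
  and gauge integrals agree.\<close>

lemma integral_mean_eq_circle_integral:
  assumes f: "f \<in> hol_disk" and p: "p > 0" and r: "0 \<le> r" "r < 1"
  shows "integral_mean p f r = circle_integral (\<lambda>z. norm (f z) powr p) r / (2*pi)"
proof -
  have [measurable]: "f \<in> borel_measurable borel" using f by (rule borel_measurable_hol_disk)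
  have [measurable]: "cis \<in> borel_measurable borel"
    by (intro borel_measurable_continuous_onI continuous_intros)
  define \<phi> where "\<phi> t = norm (f (of_real r * cis t)) powr p" for t
  have [measurable]: "\<phi> \<in> borel_measurable borel" unfolding \<phi>_def by measurable
  have "continuous_on (cball 0 r) f" using f r
    by (auto simp: hol_disk_def intro: continuous_on_subset holomorphic_on_imp_continuous_on)
  then have cont: "continuous_on A \<phi>" for A
    unfolding \<phi>_def using continuous_on_circle[OF continuous_on_norm_powr[OF _ p], of r f r] r by auto
  have dens: "uniform_measure lborel {0..2*pi} = density lborel (\<lambda>t. ennreal (indicator {0..2*pi} t / (2*pi)))"
    unfolding uniform_measure_def
    by (intro arg_cong[of _ _ "density lborel"] ext)
       (auto simp: indicator_def divide_ennreal simp flip: ennreal_1)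
  have "integral_mean p f r = (LINT t|uniform_measure lborel {0..2*pi}. \<phi> t)"
    unfolding integral_mean_def circle_measure_def \<phi>_def by (subst integral_distr) auto
  also have "\<dots> = (LINT t|lborel. indicator {0..2*pi} t / (2*pi) * \<phi> t)"
    unfolding dens by (subst integral_real_density) auto
  also have "\<dots> = (LINT t:{0..2*pi}|lborel. \<phi> t) / (2*pi)"
    by (simp add: set_lebesgue_integral_def)
  also have "(LINT t:{0..2*pi}|lborel. \<phi> t) = integral {0..2*pi} \<phi>"
    by (rule set_borel_integral_eq_integral)
       (use borel_integrable_compact[OF compact_Icc cont] in
          \<open>auto simp: set_integrable_def scaleR_conv_of_real\<close>)
  finally show ?thesis by (simp add: circle_integral_def \<phi>_def[abs_def])
qed


lemma integral_mean_nonneg: "integral_mean p f r \<ge> 0"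
  by (simp add: integral_mean_def)

lemma integral_mean_mono:
  assumes "f \<in> hol_disk" "p > 0" "0 \<le> r" "r \<le> R" "R < 1"
  shows "integral_mean p f r \<le> integral_mean p f R"
  using circle_integral_norm_powr_mono[of f p r R] assms
  by (simp add: integral_mean_eq_circle_integral divide_right_mono hol_disk_def)

lemma eventually_at_left_1: "eventually (\<lambda>r::real. 0 < r \<and> r < 1) (at_left 1)"
  using eventually_at_left_real[of 0 "1::real"] by (auto elim: eventually_mono)

text \<open>The means increase with the radius, so they converge to their supremum exactly when they
  are bounded. Boundedness is what later membership proofs check.\<close>

lemma hardy_space_bounded_iff:
  assumes f: "f \<in> hol_disk" and p: "p > 0"
  shows "f \<in> hardy_space p \<longleftrightarrow> (\<exists>B. \<forall>r\<in>{0..<1}. integral_mean p f r \<le> B)"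
proof
  assume "f \<in> hardy_space p"
  then obtain L where L: "(integral_mean p f \<longlongrightarrow> L) (at_left 1)" by (auto simp: hardy_space_def)
  have "integral_mean p f r \<le> L" if r: "r \<in> {0..<1}" for r
  proof (rule tendsto_lowerbound[OF L])
    have "eventually (\<lambda>R. r < R \<and> R < 1) (at_left 1)"
      using eventually_at_left_real[of r "1::real"] r by (auto elim: eventually_mono)
    then show "eventually (\<lambda>R. integral_mean p f r \<le> integral_mean p f R) (at_left 1)"
      by eventually_elim (use r in \<open>auto intro: integral_mean_mono[OF f p]\<close>)
  qed simp
  then show "\<exists>B. \<forall>r\<in>{0..<1}. integral_mean p f r \<le> B" by blast
next
  assume "\<exists>B. \<forall>r\<in>{0..<1}. integral_mean p f r \<le> B"
  then have bdd: "bdd_above (integral_mean p f ` {0..<1})" by (auto intro: bdd_aboveI2)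
  define L where "L = (SUP r\<in>{0..<1}. integral_mean p f r)"
  have "(integral_mean p f \<longlongrightarrow> L) (at_left 1)"
  proof (rule increasing_tendsto)
    show "eventually (\<lambda>r. integral_mean p f r \<le> L) (at_left 1)"
      using eventually_at_left_1
      by eventually_elim (auto simp: L_def intro!: cSUP_upper bdd)
  next
    fix x assume "x < L"
    then obtain q where q: "q \<in> {0..<1}" "x < integral_mean p f q"
      using less_cSUP_iff[OF _ bdd, of x] by (auto simp: L_def)
    have "eventually (\<lambda>R. q < R \<and> R < 1) (at_left 1)"
      using eventually_at_left_real[of q "1::real"] q by (auto elim: eventually_mono)
    then show "eventually (\<lambda>r. x < integral_mean p f r) (at_left 1)"
      by eventually_elim (use q in \<open>auto intro!: less_le_trans[OF q(2)] integral_mean_mono[OF f p]\<close>)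
  qed
  then show "f \<in> hardy_space p" using f by (auto simp: hardy_space_def)
qed

lemma hardy_norm_nonneg: "hardy_norm p f \<ge> 0"
  by (simp add: hardy_norm_def)

lemma integral_mean_tendsto_hardy_norm:
  assumes "f \<in> hardy_space p" "p > 0"
  shows "(integral_mean p f \<longlongrightarrow> hardy_norm p f powr p) (at_left 1)"
proof -
  obtain L where L: "(integral_mean p f \<longlongrightarrow> L) (at_left 1)" using assms by (auto simp: hardy_space_def)
  \<comment> \<open>The powers \<open>1 / p\<close> and \<open>p\<close> cancel only on nonnegative
    numbers.\<close>
  have "L \<ge> 0" by (rule tendsto_lowerbound[OF L]) (auto simp: integral_mean_nonneg)
  moreover have "Lim (at_left 1) (integral_mean p f) = L"
    by (rule tendsto_Lim[OF _ L]) simp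
  ultimately have "hardy_norm p f powr p = L" using assms by (simp add: hardy_norm_def powr_powr)
  then show ?thesis using L by simp
qed

lemma integral_mean_le_hardy_norm:
  assumes f: "f \<in> hardy_space p" and p: "p > 0" and r: "0 \<le> r" "r < 1"
  shows "integral_mean p f r \<le> hardy_norm p f powr p"
proof (rule tendsto_lowerbound[OF integral_mean_tendsto_hardy_norm[OF f p]])
  have "eventually (\<lambda>R. r < R \<and> R < 1) (at_left 1)"
    using eventually_at_left_real[of r "1::real"] r by (auto elim: eventually_mono)
  then show "eventually (\<lambda>R. integral_mean p f r \<le> integral_mean p f R) (at_left 1)"
    by eventually_elim (use r f p in \<open>auto simp: hardy_space_def intro: integral_mean_mono\<close>)
qed simp

lemma hardy_norm_powr_le:
  assumes f: "f \<in> hardy_space p" and p: "p > 0"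
    and C: "\<And>r. 0 \<le> r \<Longrightarrow> r < 1 \<Longrightarrow> integral_mean p f r \<le> C"
  shows "hardy_norm p f powr p \<le> C"
proof (rule tendsto_upperbound[OF integral_mean_tendsto_hardy_norm[OF f p]])
  show "eventually (\<lambda>r. integral_mean p f r \<le> C) (at_left 1)"
    using eventually_at_left_1 by eventually_elim (auto intro: C)
qed simp

lemma powr_le_powr_cancel:
  fixes x y p :: real
  assumes "x powr p \<le> y powr p" "p > 0" "y \<ge> 0"
  shows "x \<le> y"
proof (rule ccontr)
  assume "\<not> x \<le> y"
  then have "y powr p < x powr p" using assms by (intro powr_less_mono2) auto
  then show False using assms by simp
qed

lemma hardy_norm_le:
  assumes "f \<in> hardy_space p" "p > 0" "C \<ge> 0"
    and "\<And>r. 0 \<le> r \<Longrightarrow> r < 1 \<Longrightarrow> integral_mean p f r \<le> C powr p"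
  shows "hardy_norm p f \<le> C"
  using hardy_norm_powr_le[of f p "C powr p"] assms powr_le_powr_cancel by blast

section \<open>Triangle inequalities and the metric\<close>

text \<open>The triangle-type estimates below all start from a pointwise inequality between
  \<open>p\<close>-th powers and pass to the means through this lemma.\<close>

lemma integral_mean_le_combination:
  assumes f: "f \<in> hol_disk" and g: "g \<in> hol_disk" and h: "h \<in> hol_disk" and p: "p > 0"
    and le: "\<And>z. z \<in> unit_disk \<Longrightarrow> norm (h z) powr p \<le> a * norm (f z) powr p + b * norm (g z) powr p"
    and r: "0 \<le> r" "r < 1"
  shows "integral_mean p h r \<le> a * integral_mean p f r + b * integral_mean p g r"
proof -
  have int: "(\<lambda>t. norm (k (of_real r * cis t)) powr p) integrable_on {0..2*pi}" if "k \<in> hol_disk" for k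
    using that r
    by (intro integrable_on_circle[of r] continuous_on_norm_powr p)
       (auto simp: hol_disk_def intro: continuous_on_subset holomorphic_on_imp_continuous_on)
  have "circle_integral (\<lambda>z. norm (h z) powr p) r
      \<le> integral {0..2*pi} (\<lambda>t. a * norm (f (of_real r * cis t)) powr p + b * norm (g (of_real r * cis t)) powr p)"
    unfolding circle_integral_def
    using r by (intro integral_le int h f g le integrable_add integrable_on_mult_right) (auto simp: norm_mult)
  also have "\<dots> = a * circle_integral (\<lambda>z. norm (f z) powr p) r + b * circle_integral (\<lambda>z. norm (g z) powr p) r"
    unfolding circle_integral_def
    by (subst Henstock_Kurzweil_Integration.integral_add) (auto intro!: integrable_on_mult_right int f g)
  finally show ?thesis
    using f g h p r by (simp add: integral_mean_eq_circle_integral field_simps)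
qed

lemma hol_disk_diff:
  assumes "f \<in> hol_disk" "g \<in> hol_disk"
  shows "(\<lambda>z. f z - g z) \<in> hol_disk"
  using assms by (auto simp: hol_disk_def intro: holomorphic_on_diff)

text \<open>The sum is at most twice the maximum. This crude constant covers every
  \<open>p > 0\<close> at once and suffices for closure of the Hardy space under
  differences.\<close>

lemma powr_add_le_two_powr:
  fixes x y p :: real
  assumes "x \<ge> 0" "y \<ge> 0" "p > 0"
  shows "(x + y) powr p \<le> 2 powr p * x powr p + 2 powr p * y powr p"
proof -
  have "(x + y) powr p \<le> (2 * max x y) powr p" using assms by (intro powr_mono2) auto
  also have "\<dots> = 2 powr p * max x y powr p" using assms by (simp add: powr_mult)
  also have "\<dots> \<le> 2 powr p * x powr p + 2 powr p * y powr p"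
    by (cases "x \<le> y") (simp_all add: max_def)
  finally show ?thesis .
qed

lemma hardy_space_diff:
  assumes f: "f \<in> hardy_space p" and g: "g \<in> hardy_space p" and p: "p > 0"
  shows "(\<lambda>z. f z - g z) \<in> hardy_space p"
proof -
  have fg: "f \<in> hol_disk" "g \<in> hol_disk" using f g by (auto simp: hardy_space_def)
  have le: "norm (f z - g z) powr p \<le> 2 powr p * norm (f z) powr p + 2 powr p * norm (g z) powr p" for z
  proof -
    have "norm (f z - g z) powr p \<le> (norm (f z) + norm (g z)) powr p"
      using p by (intro powr_mono2 norm_triangle_ineq4) auto
    then show ?thesis using powr_add_le_two_powr[of "norm (f z)" "norm (g z)" p] p by simp
  qed
  have "integral_mean p (\<lambda>z. f z - g z) r \<le> 2 powr p * hardy_norm p f powr p + 2 powr p * hardy_norm p g powr p"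
    if r: "r \<in> {0..<1}" for r
  proof -
    have "integral_mean p (\<lambda>z. f z - g z) r \<le> 2 powr p * integral_mean p f r + 2 powr p * integral_mean p g r"
      using r by (intro integral_mean_le_combination fg hol_disk_diff le p) auto
    also have "\<dots> \<le> 2 powr p * hardy_norm p f powr p + 2 powr p * hardy_norm p g powr p"
      using r by (intro add_mono mult_left_mono integral_mean_le_hardy_norm f g p) auto
    finally show ?thesis .
  qed
  then show ?thesis using hardy_space_bounded_iff[OF hol_disk_diff[OF fg] p] by blast
qed

text \<open>For positive arguments this is convexity of the power. If one argument is 0, it reduces
  to \<open>s powr p <= s\<close> for a weight \<open>s\<close> in (0,1).\<close>

lemma powr_convex_nonneg:
  fixes x y t p :: real
  assumes "x \<ge> 0" "y \<ge> 0" "0 < t" "t < 1" "p \<ge> 1"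
  shows "(t * x + (1 - t) * y) powr p \<le> t * x powr p + (1 - t) * y powr p"
proof -
  have zero: "(s * w) powr p \<le> s * w powr p" if "0 < s" "s < 1" "w \<ge> 0" for s w :: real
  proof -
    have "s powr p \<le> s powr 1" using that assms by (intro powr_mono') auto
    then show ?thesis using that by (simp add: powr_mult mult_right_mono)
  qed
  consider "x = 0" | "y = 0" | "x > 0" "y > 0" using assms by linarith
  then show ?thesis
  proof cases
    case 1
    then show ?thesis using zero[of "1 - t" y] assms by simp
  next
    case 2
    then show ?thesis using zero[of t x] assms by simp
  next
    case 3
    then show ?thesis
      using convex_onD[OF powr_convex[of p], of "1 - t" x y] assms by simp
  qed
qed

text \<open>The weights \<open>A\<close>, \<open>B\<close> below exceed the two norms by \<open>e/2\<close> so that normalising by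
  them never divides by 0.\<close>

lemma hardy_norm_triangle:
  assumes f: "f \<in> hardy_space p" and g: "g \<in> hardy_space p" and h: "h \<in> hardy_space p"
    and p: "p \<ge> 1" and eq: "\<And>z. h z = f z + g z"
  shows "hardy_norm p h \<le> hardy_norm p f + hardy_norm p g"
proof (rule field_le_epsilon)
  fix e :: real assume e: "e > 0"
  have fgh: "f \<in> hol_disk" "g \<in> hol_disk" "h \<in> hol_disk" using f g h by (auto simp: hardy_space_def)
  have p0: "p > 0" using p by simp
  define A where "A = hardy_norm p f + e/2"
  define B where "B = hardy_norm p g + e/2"
  have AB: "A > 0" "B > 0" using e hardy_norm_nonneg[of p f] hardy_norm_nonneg[of p g] by (auto simp: A_def B_def)
  \<comment> \<open>With these weights \<open>(f + g) / (A + B)\<close> is the convex combination of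
    \<open>f / A\<close> and \<open>g / B\<close>, whose norms are at most 1; this is the usual
    proof of Minkowski's inequality by convexity.\<close>
  define t where "t = A / (A + B)"
  have t: "0 < t" "t < 1" "1 - t = B / (A + B)" using AB by (auto simp: t_def field_simps)
  define a where "a = (A + B) powr p * t / A powr p"
  define b where "b = (A + B) powr p * (1 - t) / B powr p"
  have ab: "a \<ge> 0" "b \<ge> 0" using AB t by (auto simp: a_def b_def)
  have le: "norm (h z) powr p \<le> a * norm (f z) powr p + b * norm (g z) powr p" for z
  proof -
    have "norm (h z) powr p \<le> (norm (f z) + norm (g z)) powr p"
      unfolding eq using p0 by (intro powr_mono2 norm_triangle_ineq) auto
    also have "norm (f z) + norm (g z) = (A + B) * (t * (norm (f z) / A) + (1 - t) * (norm (g z) / B))"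
    proof -
      have "(A + B) * t = A" "(A + B) * (1 - t) = B" using AB unfolding t by (simp_all add: t_def)
      then show ?thesis using AB by (simp add: distrib_left flip: mult.assoc)
    qed
    also have "\<dots> powr p = (A + B) powr p * (t * (norm (f z) / A) + (1 - t) * (norm (g z) / B)) powr p"
      using AB t by (subst powr_mult) auto
    also have "\<dots> \<le> (A + B) powr p * (t * (norm (f z) / A) powr p + (1 - t) * (norm (g z) / B) powr p)"
      using AB t p by (intro mult_left_mono powr_convex_nonneg) auto
    also have "\<dots> = a * norm (f z) powr p + b * norm (g z) powr p"
      using AB by (simp add: powr_divide a_def b_def field_simps)
    finally show ?thesis .
  qed
  have "hardy_norm p h \<le> A + B"
  proof (rule hardy_norm_le[OF h p0])
    fix r :: real assume r: "0 \<le> r" "r < 1"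
    have "integral_mean p h r \<le> a * integral_mean p f r + b * integral_mean p g r"
      by (intro integral_mean_le_combination fgh le p0 r)
    also have "\<dots> \<le> a * hardy_norm p f powr p + b * hardy_norm p g powr p"
      using ab by (intro add_mono mult_left_mono integral_mean_le_hardy_norm f g p0 r)
    also have "\<dots> \<le> a * A powr p + b * B powr p"
      using ab e p0 by (intro add_mono mult_left_mono powr_mono2) (auto simp: A_def B_def hardy_norm_nonneg)
    also have "\<dots> = (A + B) powr p" using AB by (simp add: a_def b_def flip: distrib_left)
    finally show "integral_mean p h r \<le> (A + B) powr p" .
  qed (use AB in auto)
  then show "hardy_norm p h \<le> hardy_norm p f + hardy_norm p g + e" by (simp add: A_def B_def)
qed

text \<open>After division by \<open>x + y\<close> both terms lie in [0,1], where a power with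
  exponent at most 1 does not decrease a number; the two quotients add up to 1.\<close>

lemma powr_subadditive:
  fixes x y p :: real
  assumes "x \<ge> 0" "y \<ge> 0" "0 < p" "p \<le> 1"
  shows "(x + y) powr p \<le> x powr p + y powr p"
proof (cases "x + y = 0")
  case True
  then show ?thesis using assms by simp
next
  case False
  then have s: "x + y > 0" using assms by linarith
  have *: "w / (x + y) \<le> (w / (x + y)) powr p" if "0 \<le> w" "w \<le> x + y" for w
    using powr_mono'[of p 1 "w / (x + y)"] that assms s by (simp add: divide_le_eq)
  have "1 = x / (x + y) + y / (x + y)" using s by (simp flip: add_divide_distrib)
  also have "\<dots> \<le> (x / (x + y)) powr p + (y / (x + y)) powr p"
    using assms by (intro add_mono *) auto
  also have "\<dots> = (x powr p + y powr p) / (x + y) powr p"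
    using assms by (simp add: powr_divide add_divide_distrib)
  finally show ?thesis using s by (simp add: le_divide_eq)
qed

lemma hardy_norm_powr_triangle:
  assumes f: "f \<in> hardy_space p" and g: "g \<in> hardy_space p" and h: "h \<in> hardy_space p"
    and p: "0 < p" "p \<le> 1" and eq: "\<And>z. h z = f z + g z"
  shows "hardy_norm p h powr p \<le> hardy_norm p f powr p + hardy_norm p g powr p"
proof (rule hardy_norm_powr_le[OF h p(1)])
  fix r :: real assume r: "0 \<le> r" "r < 1"
  have fgh: "f \<in> hol_disk" "g \<in> hol_disk" "h \<in> hol_disk" using f g h by (auto simp: hardy_space_def)
  have le: "norm (h z) powr p \<le> 1 * norm (f z) powr p + 1 * norm (g z) powr p" for z
  proof -
    have "norm (h z) powr p \<le> (norm (f z) + norm (g z)) powr p"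
      unfolding eq using p by (intro powr_mono2 norm_triangle_ineq) auto
    then show ?thesis using powr_subadditive[of "norm (f z)" "norm (g z)" p] p by simp
  qed
  have "integral_mean p h r \<le> 1 * integral_mean p f r + 1 * integral_mean p g r"
    by (intro integral_mean_le_combination fgh le p r)
  also have "\<dots> \<le> hardy_norm p f powr p + hardy_norm p g powr p"
    using integral_mean_le_hardy_norm[OF f p(1) r] integral_mean_le_hardy_norm[OF g p(1) r] by simp
  finally show "integral_mean p h r \<le> hardy_norm p f powr p + hardy_norm p g powr p" .
qed

text \<open>Every mean is bounded by the norm and hence vanishes. A continuous nonnegative integrand
  with integral 0 is 0, so \<open>f\<close> vanishes on each circle; off the disk it is 0 by
  convention.\<close>

lemma hardy_norm_eq_0D:
  assumes f: "f \<in> hardy_space p" and p: "p > 0" and "hardy_norm p f = 0"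
  shows "f z = 0"
proof (cases "z \<in> unit_disk")
  case True
  have fh: "f \<in> hol_disk" using f by (auto simp: hardy_space_def)
  define r where "r = norm z"
  have r: "0 \<le> r" "r < 1" using True by (auto simp: r_def)
  have "integral_mean p f r = 0"
    using integral_mean_le_hardy_norm[OF f p r] assms(3) integral_mean_nonneg[of p f r] by simp
  then have "integral {0..2*pi} (\<lambda>t. norm (f (of_real r * cis t)) powr p) = 0"
    using integral_mean_eq_circle_integral[OF fh p r] by (simp add: circle_integral_def)
  moreover have "continuous_on {0..2*pi} (\<lambda>t. norm (f (of_real r * cis t)) powr p)"
    using fh r by (intro continuous_on_circle[of r] continuous_on_norm_powr p)
       (auto simp: hol_disk_def intro: continuous_on_subset holomorphic_on_imp_continuous_on)
  ultimately have 0: "\<And>t. t \<in> {0..2*pi} \<Longrightarrow> norm (f (of_real r * cis t)) powr p = 0"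
    by (subst (asm) integral_eq_0_iff) auto
  have "z = of_real r * cis (Arg2pi z)" using Arg2pi_eq[of z] by (simp add: r_def cis_conv_exp)
  then show ?thesis using 0[of "Arg2pi z"] Arg2pi_ge_0[of z] Arg2pi_lt_2pi[of z] by auto
next
  case False
  then show ?thesis using f by (auto simp: hardy_space_def hol_disk_def)
qed

lemma integral_mean_zero: "p > 0 \<Longrightarrow> integral_mean p (\<lambda>z. 0) r = 0"
  by (simp add: integral_mean_def)

lemma zero_in_hardy_space: "p > 0 \<Longrightarrow> (\<lambda>z. 0) \<in> hardy_space p"
  by (subst hardy_space_bounded_iff) (auto simp: hol_disk_def integral_mean_zero intro!: exI[of _ 0])

lemma hardy_norm_zero:
  assumes "p > 0"
  shows "hardy_norm p (\<lambda>z. 0) = 0"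
  using hardy_norm_le[OF zero_in_hardy_space[OF assms] assms, of 0] assms hardy_norm_nonneg[of p "\<lambda>z. 0"]
  by (simp add: integral_mean_zero)

lemma Metric_space_hardy:
  assumes p: "p > 0"
  shows "Metric_space (hardy_space p) (hardy_dist p)"
proof
  fix f g h
  show "0 \<le> hardy_dist p f g" by (simp add: hardy_dist_def)
  show "hardy_dist p f g = hardy_dist p g f"
    by (simp add: hardy_dist_def hardy_norm_def integral_mean_def[abs_def] norm_minus_commute)
  assume f: "f \<in> hardy_space p" and g: "g \<in> hardy_space p"
  show "hardy_dist p f g = 0 \<longleftrightarrow> f = g"
  proof
    assume "hardy_dist p f g = 0"
    then have "hardy_norm p (\<lambda>z. f z - g z) = 0" using p by (simp add: hardy_dist_def)
    then show "f = g" using hardy_norm_eq_0D[OF hardy_space_diff[OF f g p] p] by auto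
  next
    assume "f = g"
    then show "hardy_dist p f g = 0" using hardy_norm_zero[OF p] p by (simp add: hardy_dist_def)
  qed
  assume h: "h \<in> hardy_space p"
  show "hardy_dist p f h \<le> hardy_dist p f g + hardy_dist p g h"
  \<comment> \<open>The exponent \<open>min 1 p\<close> is 1 in the first case, where the norm
    itself is subadditive, and \<open>p\<close> in the second, where its \<open>p\<close>-th power
    is.\<close>
  proof (cases "p \<ge> 1")
    case True
    then show ?thesis
      using hardy_norm_triangle[OF hardy_space_diff[OF f g p] hardy_space_diff[OF g h p] hardy_space_diff[OF f h p]]
      by (simp add: hardy_dist_def min_def hardy_norm_nonneg split: if_splits)
  next
    case False
    then show ?thesis
      using hardy_norm_powr_triangle[OF hardy_space_diff[OF f g p] hardy_space_diff[OF g h p] hardy_space_diff[OF f h p] p]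
      by (simp add: hardy_dist_def min_def)
  qed
qed

section \<open>Leading Taylor coefficients are bounded by the norm\<close>

text \<open>Dividing by \<open>z ^ m\<close> leaves a removable singularity with value
  \<open>c\<close> at 0. Monotonicity from radius 0 to \<open>r\<close> compares
  \<open>norm c powr p\<close> with the mean of \<open>f\<close> divided by
  \<open>(r ^ m) powr p\<close>, and this divisor tends to 1.\<close>

lemma hardy_norm_ge_coefficient:
  assumes f: "f \<in> hardy_space p" and p: "p > 0" and c: "((\<lambda>z. f z / z ^ m) \<longlongrightarrow> c) (at 0)"
  shows "norm c \<le> hardy_norm p f"
proof -
  have fh: "f \<in> hol_disk" using f by (auto simp: hardy_space_def)
  define h where "h z = (if z = 0 then c else f z / z ^ m)" for z
  have h: "h holomorphic_on unit_disk"
  proof (rule no_isolated_singularity')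
    have "(\<lambda>z. f z / z ^ m) holomorphic_on unit_disk - {0}"
      using fh by (intro holomorphic_intros) (auto simp: hol_disk_def intro: holomorphic_on_subset)
    then show "h holomorphic_on unit_disk - {0}"
      by (rule holomorphic_transform) (auto simp: h_def)
    have "(h \<longlongrightarrow> c) (at 0)"
      by (rule Lim_transform_eventually[OF c]) (auto simp: h_def eventually_at_filter)
    then show "(h \<longlongrightarrow> h z) (at z within unit_disk)" if "z \<in> {0}" for z
      using that by (auto simp: h_def intro: tendsto_within_subset)
  qed auto
  have le: "norm c powr p * (r ^ m) powr p \<le> integral_mean p f r" if r: "0 < r" "r < 1" for r
  proof -
    have "2 * pi * norm c powr p = circle_integral (\<lambda>z. norm (h z) powr p) 0"
      by (simp add: circle_integral_def h_def)
    also have "\<dots> \<le> circle_integral (\<lambda>z. norm (h z) powr p) r"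
      using r by (intro circle_integral_norm_powr_mono h p) auto
    also have "\<dots> = integral {0..2*pi} (\<lambda>t. norm (f (of_real r * cis t)) powr p / (r ^ m) powr p)"
      using r by (simp add: circle_integral_def h_def norm_divide norm_power norm_mult powr_divide)
    also have "\<dots> = 2 * pi * integral_mean p f r / (r ^ m) powr p"
      using integral_mean_eq_circle_integral[OF fh p, of r] r by (simp add: circle_integral_def)
    finally show ?thesis using r by (simp add: field_simps)
  qed
  have "norm c powr p \<le> hardy_norm p f powr p"
  proof (rule tendsto_le[OF _ integral_mean_tendsto_hardy_norm[OF f p]])
    have "((\<lambda>r::real. norm c powr p * (r ^ m) powr p) \<longlongrightarrow> norm c powr p * (1 ^ m) powr p) (at_left 1)"
      by (intro tendsto_intros) auto
    then show "((\<lambda>r::real. norm c powr p * (r ^ m) powr p) \<longlongrightarrow> norm c powr p) (at_left 1)" by simp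
    show "eventually (\<lambda>r. norm c powr p * (r ^ m) powr p \<le> integral_mean p f r) (at_left 1)"
      using eventually_at_left_1 by eventually_elim (auto intro: le)
  qed simp
  then show ?thesis using p hardy_norm_nonneg by (rule powr_le_powr_cancel)
qed

section \<open>Monomials and the derivative of the Volterra operator\<close>

definition disk_monomial :: "nat \<Rightarrow> complex \<Rightarrow> complex" where
  "disk_monomial n z = (if z \<in> unit_disk then z ^ n else 0)"

lemma disk_monomial_hol_disk: "disk_monomial n \<in> hol_disk"
proof -
  have "disk_monomial n holomorphic_on unit_disk"
    by (rule holomorphic_transform[of "\<lambda>z. z ^ n"]) (auto simp: disk_monomial_def intro!: holomorphic_intros)
  then show ?thesis by (auto simp: hol_disk_def disk_monomial_def)
qed

lemma integral_mean_disk_monomial_le: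
  assumes "p > 0" "0 \<le> r" "r < 1"
  shows "integral_mean p (disk_monomial n) r \<le> 1"
proof -
  have "integral_mean p (disk_monomial n) r = (r ^ n) powr p"
    using assms
    by (simp add: integral_mean_eq_circle_integral[OF disk_monomial_hol_disk] circle_integral_def
          disk_monomial_def norm_mult norm_power)
  also have "\<dots> \<le> 1 powr p" using assms by (intro powr_mono2) (auto simp: power_le_one)
  finally show ?thesis by simp
qed

lemma disk_monomial_unit_ball:
  assumes "p > 0"
  shows "disk_monomial n \<in> hardy_space p" "hardy_norm p (disk_monomial n) \<le> 1"
proof -
  show *: "disk_monomial n \<in> hardy_space p"
    using hardy_space_bounded_iff[OF disk_monomial_hol_disk assms] integral_mean_disk_monomial_le[OF assms]
    by (auto intro!: exI[of _ 1])
  show "hardy_norm p (disk_monomial n) \<le> 1"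
    by (rule hardy_norm_le[OF * assms]) (auto intro: integral_mean_disk_monomial_le[OF assms])
qed

lemma deriv_disk_monomial:
  assumes "z \<in> unit_disk"
  shows "deriv (disk_monomial n) z = of_nat n * z ^ (n - 1)"
proof (rule DERIV_imp_deriv)
  have "((\<lambda>z. z ^ n) has_field_derivative of_nat n * z ^ (n - 1)) (at z)"
    by (auto intro!: derivative_eq_intros)
  then show "(disk_monomial n has_field_derivative of_nat n * z ^ (n - 1)) (at z)"
    by (rule has_field_derivative_transform_within_open[of _ _ _ unit_disk])
       (use assms in \<open>auto simp: disk_monomial_def\<close>)
qed

text \<open>On the convex disk the integrand has a primitive, and the integral along the segment
  from 0 is an increment of it.\<close>

lemma volterra_S_has_field_derivative:
  assumes f: "f holomorphic_on unit_disk" and g: "g holomorphic_on unit_disk" and z: "z \<in> unit_disk"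
  shows "(volterra_S g f has_field_derivative deriv f z * g z) (at z)"
proof -
  have "(\<lambda>w. deriv f w * g w) holomorphic_on unit_disk"
    by (intro holomorphic_intros f g holomorphic_deriv) auto
  then obtain F where F: "\<And>w. w \<in> unit_disk \<Longrightarrow> (F has_field_derivative deriv f w * g w) (at w within unit_disk)"
    by (rule holomorphic_convex_primitive'[rotated 2]) auto
  have eq: "F w - F 0 = volterra_S g f w" if "w \<in> unit_disk" for w
  proof -
    have "path_image (linepath 0 w) \<subseteq> unit_disk"
      using that by (simp only: path_image_linepath) (rule closed_segment_subset, auto)
    then have "((\<lambda>w. deriv f w * g w) has_contour_integral F w - F 0) (linepath 0 w)"
      using contour_integral_primitive[OF F, of "linepath 0 w"] by auto
    then show ?thesis using that by (simp add: volterra_S_def contour_integral_unique)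
  qed
  have "((\<lambda>w. F w - F 0) has_field_derivative deriv f z * g z) (at z)"
    using F[OF z] at_within_open[OF z] by (auto intro!: derivative_eq_intros)
  then show ?thesis
    by (rule has_field_derivative_transform_within_open[of _ _ _ unit_disk]) (use z eq in auto)
qed

lemma volterra_S_0 [simp]: "volterra_S g f 0 = 0"
  by (simp add: volterra_S_def)

section \<open>Leading terms and separation of the images\<close>

text \<open>Subtracting the primitive of \<open>F 0 * z ^ N\<close> leaves a remainder
  \<open>v\<close> with derivative \<open>z ^ N * (F z - F 0)\<close>. By continuity of
  \<open>F\<close> and the mean value inequality, \<open>v\<close> is small compared with
  \<open>z ^ Suc N\<close>.\<close>

lemma primitive_leading_coefficient:
  fixes d F :: "complex \<Rightarrow> complex"
  assumes \<rho>: "\<rho> > 0" and d: "\<And>z. z \<in> ball 0 \<rho> \<Longrightarrow> (d has_field_derivative z ^ N * F z) (at z)"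
    and d0: "d 0 = 0" and F: "isCont F 0"
  shows "((\<lambda>z. d z / z ^ Suc N) \<longlongrightarrow> F 0 / of_nat (Suc N)) (at 0)"
proof (rule LIM_I)
  fix e :: real assume e: "e > 0"
  obtain s where s: "s > 0" "\<And>z. norm z < s \<Longrightarrow> norm (F z - F 0) < e/2"
    using F e unfolding continuous_at_eps_delta by (metis diff_zero dist_norm half_gt_zero)
  define v where "v z = d z - F 0 / of_nat (Suc N) * z ^ Suc N" for z
  have v: "(v has_field_derivative z ^ N * (F z - F 0)) (at z)" if "z \<in> ball 0 \<rho>" for z
    unfolding v_def
    by (rule derivative_eq_intros d that refl)+ (simp add: field_simps del: of_nat_Suc)
  have "norm (d z / z ^ Suc N - F 0 / of_nat (Suc N)) < e" if z: "z \<noteq> 0" "norm z < min \<rho> s" for z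
  proof -
    have "norm (v z - v 0) \<le> (norm z ^ N * (e/2)) * norm (z - 0)"
    proof (rule field_differentiable_bound[of "cball 0 (norm z)"])
      show "(v has_field_derivative w ^ N * (F w - F 0)) (at w within cball 0 (norm z))"
        if "w \<in> cball 0 (norm z)" for w
        using v[of w] that z by (auto intro: has_field_derivative_at_within)
      show "norm (w ^ N * (F w - F 0)) \<le> norm z ^ N * (e/2)" if "w \<in> cball 0 (norm z)" for w
        unfolding norm_mult norm_power
        using s(2)[of w] that z by (intro mult_mono power_mono) auto
    qed auto
    then have "norm (v z) \<le> norm z ^ Suc N * (e/2)" by (simp add: v_def d0 mult_ac)
    moreover have "d z / z ^ Suc N - F 0 / of_nat (Suc N) = v z / z ^ Suc N"
      using z by (simp add: v_def diff_divide_distrib)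
    moreover have "norm z ^ Suc N > 0" using z by simp
    ultimately have "norm (d z / z ^ Suc N - F 0 / of_nat (Suc N)) \<le> e/2"
      by (simp add: norm_divide norm_power divide_le_eq mult_ac del: power_Suc)
    then show ?thesis using e by simp
  qed
  then show "\<exists>q>0. \<forall>z. z \<noteq> 0 \<and> norm (z - 0) < q \<longrightarrow> norm (d z / z ^ Suc N - F 0 / of_nat (Suc N)) < e"
    using \<rho> s by (intro exI[of _ "min \<rho> s"]) auto
qed

text \<open>A zero of \<open>g\<close> at 0 has finite order because \<open>g\<close> is not
  constant; if \<open>g 0\<close> is nonzero, the order is \<open>k = 0\<close> and \<open>G\<close>
  is \<open>g\<close>.\<close>

lemma holomorphic_factor_at_0:
  assumes g: "g holomorphic_on unit_disk" and "z0 \<in> unit_disk" "g z0 \<noteq> 0"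
  obtains G \<rho> k where "\<rho> > 0" "\<rho> \<le> 1" "G holomorphic_on ball 0 \<rho>" "G 0 \<noteq> 0"
    "\<And>z. z \<in> ball 0 \<rho> \<Longrightarrow> g z = z ^ k * G z"
proof (cases "g 0 = 0")
  case True
  have "\<not> g constant_on unit_disk"
    using True assms unfolding constant_on_def by (metis centre_in_ball zero_less_one)
  then obtain G \<rho> k where "0 < k" "0 < \<rho>" "ball 0 \<rho> \<subseteq> unit_disk" "G holomorphic_on ball 0 \<rho>"
      "\<And>w. w \<in> ball 0 \<rho> \<Longrightarrow> g w = (w - 0) ^ k * G w" "\<And>w. w \<in> ball 0 \<rho> \<Longrightarrow> G w \<noteq> 0"
    using holomorphic_factor_zero_nonconstant[OF g open_ball connected_ball, of 0] True
    by (metis centre_in_ball zero_less_one)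
  then show ?thesis using that[of \<rho> G k] by (auto simp: ball_subset_ball_iff)
next
  case False
  then show ?thesis using that[of 1 g 0] g by auto
qed

text \<open>For \<open>n < m\<close> the difference of the images of \<open>z\<^sup>n\<close> and \<open>z\<^sup>m\<close> vanishes at 0 to the order
  \<open>n + k\<close> exactly, where \<open>k\<close> is the order of \<open>g\<close>, and its leading coefficient is
  \<open>b n / (n + k)\<close>, where \<open>b\<close> is that of \<open>g\<close>.\<close>

lemma volterra_S_monomials_separated:
  assumes g: "g holomorphic_on unit_disk" and nz: "z0 \<in> unit_disk" "g z0 \<noteq> 0" and p: "p > 0"
    and S: "\<And>n. volterra_S g (disk_monomial n) \<in> hardy_space p"
  obtains c where "c > 0" "\<And>n m. 0 < n \<Longrightarrow> n < m \<Longrightarrow>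
    c \<le> hardy_dist p (volterra_S g (disk_monomial n)) (volterra_S g (disk_monomial m))"
proof -
  obtain G \<rho> k where G: "\<rho> > 0" "\<rho> \<le> 1" "G holomorphic_on ball 0 \<rho>" "G 0 \<noteq> 0"
    "\<And>z. z \<in> ball 0 \<rho> \<Longrightarrow> g z = z ^ k * G z"
    using holomorphic_factor_at_0[OF g nz] by metis
  have contG: "isCont G 0"
    using G holomorphic_on_imp_continuous_on[OF G(3)] by (auto simp: continuous_on_eq_continuous_at)
  \<comment> \<open>For \<open>n >= 1\<close> the factor \<open>n / (n + k)\<close> is smallest at
    \<open>n = 1\<close>, so this bound on the leading coefficients is uniform in
    \<open>n\<close>.\<close>
  define c where "c = norm (G 0) / (1 + real k)"
  have c: "c > 0" using G by (auto simp: c_def)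
  have "c powr min 1 p \<le> hardy_dist p (volterra_S g (disk_monomial n)) (volterra_S g (disk_monomial m))"
    if nm: "0 < n" "n < m" for n m
  proof -
    define d where "d z = volterra_S g (disk_monomial n) z - volterra_S g (disk_monomial m) z" for z
    \<comment> \<open>\<open>z ^ N\<close> is the common power in the derivatives of both images.
      The truncated subtraction is harmless as \<open>0 < n\<close>, and \<open>n < m\<close> makes
      the second term of \<open>F\<close> vanish at 0.\<close>
    define N where "N = n - 1 + k"
    define F where "F z = (of_nat n - of_nat m * z ^ (m - n)) * G z" for z
    have dd: "(d has_field_derivative z ^ N * F z) (at z)" if z: "z \<in> ball 0 \<rho>" for z
    proof -
      have z1: "z \<in> unit_disk" using z G by auto
      have hol: "disk_monomial j holomorphic_on unit_disk" for j
        using disk_monomial_hol_disk by (auto simp: hol_disk_def)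
      have "(d has_field_derivative of_nat n * z ^ (n - 1) * g z - of_nat m * z ^ (m - 1) * g z) (at z)"
        unfolding d_def
        using volterra_S_has_field_derivative[OF hol g z1, of n] volterra_S_has_field_derivative[OF hol g z1, of m]
        by (intro DERIV_diff) (simp_all add: deriv_disk_monomial[OF z1])
      moreover have "m - 1 = (n - 1) + (m - n)" using nm by auto
      then have "z ^ (m - 1) = z ^ (n - 1) * z ^ (m - n)" by (simp only: power_add)
      then have "of_nat n * z ^ (n - 1) * g z - of_nat m * z ^ (m - 1) * g z = z ^ N * F z"
        using G(5)[OF z] by (simp add: N_def F_def power_add algebra_simps)
      ultimately show ?thesis by simp
    qed
    have F0: "F 0 = of_nat n * G 0" using nm by (simp add: F_def)
    have contF: "isCont F 0" unfolding F_def by (intro continuous_intros contG)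
    have sN: "real (Suc N) = real n + real k" using nm by (simp add: N_def of_nat_diff)
    have "((\<lambda>z. d z / z ^ Suc N) \<longlongrightarrow> F 0 / of_nat (Suc N)) (at 0)"
      by (rule primitive_leading_coefficient[OF G(1) dd _ contF]) (auto simp: d_def)
    moreover have "d \<in> hardy_space p" unfolding d_def[abs_def] by (intro hardy_space_diff S p)
    ultimately have "norm (F 0 / of_nat (Suc N)) \<le> hardy_norm p d"
      by (intro hardy_norm_ge_coefficient p)
    moreover have "c \<le> norm (F 0 / of_nat (Suc N))"
    proof -
      have "1 / (1 + real k) \<le> real n / (real n + real k)"
        using nm by (simp add: field_simps) (use mult_left_mono[of 1 "real n" "real k"] in simp)
      then have "norm (G 0) * (1 / (1 + real k)) \<le> norm (G 0) * (real n / (real n + real k))"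
        by (rule mult_left_mono) simp
      then show ?thesis by (simp add: c_def F0 norm_divide norm_mult sN mult_ac del: of_nat_Suc)
    qed
    ultimately have "c \<le> hardy_norm p d" by simp
    then show ?thesis unfolding hardy_dist_def d_def using c p by (intro powr_mono2) auto
  qed
  then show ?thesis using that[of "c powr min 1 p"] c by auto
qed

section \<open>The zero symbol and the equivalence\<close>

lemma volterra_S_eq_zero:
  assumes "\<And>z. z \<in> unit_disk \<Longrightarrow> g z = 0"
  shows "volterra_S g f = (\<lambda>z. 0)"
proof
  fix z
  show "volterra_S g f z = 0"
  proof (cases "z \<in> unit_disk")
    case True
    then have sub: "path_image (linepath 0 z) \<subseteq> unit_disk"
      by (simp only: path_image_linepath) (rule closed_segment_subset, auto)
    have "contour_integral (linepath 0 z) (\<lambda>w. deriv f w * g w) = contour_integral (linepath 0 z) (\<lambda>w. 0)"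
      by (rule contour_integral_eq) (use sub assms in auto)
    then show ?thesis by (simp add: volterra_S_def)
  qed (simp add: volterra_S_def)
qed

theorem proposition2:
  fixes g :: "complex \<Rightarrow> complex" and p :: real
  assumes "g holomorphic_on unit_disk" and "0 < p"
  shows "hardy_compact_operator p (volterra_S g) \<longleftrightarrow> (\<forall>z\<in>unit_disk. g z = 0)"
proof
  interpret Metric_space "hardy_space p" "hardy_dist p" by (rule Metric_space_hardy[OF assms(2)])
  assume compact: "hardy_compact_operator p (volterra_S g)"
  show "\<forall>z\<in>unit_disk. g z = 0"
  proof (rule ccontr)
    assume "\<not> (\<forall>z\<in>unit_disk. g z = 0)"
    then obtain z0 where z0: "z0 \<in> unit_disk" "g z0 \<noteq> 0" by blast
    define B where "B = volterra_S g ` {f \<in> hardy_space p. hardy_norm p f \<le> 1}"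
    \<comment> \<open>The index starts at 1 because the constant monomial is mapped to 0 and the
      separation requires positive exponents.\<close>
    define u where "u n = volterra_S g (disk_monomial (Suc n))" for n
    have into: "volterra_S g ` hardy_space p \<subseteq> hardy_space p"
      and cpt: "compactin mtopology (mtopology closure_of B)"
      using compact by (auto simp: hardy_compact_operator_def hardy_topology_def B_def)
    have S: "volterra_S g (disk_monomial n) \<in> hardy_space p" for n
      using into disk_monomial_unit_ball[OF assms(2)] by blast
    obtain c where c: "c > 0" "\<And>n m. 0 < n \<Longrightarrow> n < m \<Longrightarrow>
        c \<le> hardy_dist p (volterra_S g (disk_monomial n)) (volterra_S g (disk_monomial m))"
      using volterra_S_monomials_separated[OF assms(1) z0 assms(2) S] by metis
    have "B \<subseteq> mtopology closure_of B"
      by (rule closure_of_subset) (use into in \<open>auto simp: B_def\<close>)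
    then have "range u \<subseteq> mtopology closure_of B"
      using disk_monomial_unit_ball[OF assms(2)] by (auto simp: u_def B_def)
    then obtain l r where r: "strict_mono (r :: nat \<Rightarrow> nat)" and l: "limitin mtopology (u \<circ> r) l sequentially"
      using cpt unfolding compactin_sequentially by blast
    \<comment> \<open>Two consecutive terms of the subsequence within \<open>c / 2\<close> of the
      limit contradict the separation by \<open>c\<close>.\<close>
    obtain N where lM: "l \<in> hardy_space p" and N: "\<And>n. n \<ge> N \<Longrightarrow> hardy_dist p (u (r n)) l < c / 2"
      using l c(1) unfolding limit_metric_sequentially o_def by (metis half_gt_zero)
    have "c \<le> hardy_dist p (u (r N)) (u (r (Suc N)))"
      unfolding u_def by (rule c) (use strict_monoD[OF r, of N "Suc N"] in auto)
    also have "\<dots> \<le> hardy_dist p (u (r N)) l + hardy_dist p l (u (r (Suc N)))"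
      by (rule triangle) (use lM S in \<open>auto simp: u_def\<close>)
    also have "\<dots> < c" using N[of N] N[of "Suc N"] commute[of l] by simp
    finally show False by simp
  qed
next
  interpret Metric_space "hardy_space p" "hardy_dist p" by (rule Metric_space_hardy[OF assms(2)])
  assume "\<forall>z\<in>unit_disk. g z = 0"
  then have S: "volterra_S g = (\<lambda>f z. 0)" using volterra_S_eq_zero by blast
  note zero = zero_in_hardy_space[OF assms(2)]
  \<comment> \<open>The image of the unit ball is a single point, which is closed in a Hausdorff
    space and compact.\<close>
  have "volterra_S g ` {f \<in> hardy_space p. hardy_norm p f \<le> 1} = {\<lambda>z. 0}"
    using zero hardy_norm_zero[OF assms(2)] by (auto simp: S image_iff intro!: exI[of _ "\<lambda>z. 0"])
  moreover have "mtopology closure_of {\<lambda>z. 0} = {\<lambda>z. 0}"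
    using zero by (intro closure_of_closedin closedin_Hausdorff_singleton Hausdorff_space_mtopology) auto
  moreover have "compactin mtopology {\<lambda>z. 0}"
    using zero by (intro finite_imp_compactin) auto
  ultimately show "hardy_compact_operator p (volterra_S g)"
    using zero by (auto simp: hardy_compact_operator_def hardy_topology_def S)
qed

end
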